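(* Let $\mathbb{F}_q$ be the finite field with $q$ elements, where $q\geq 3$, let $k$ be an integer with $1\le k\leq q$, and let $a_1,a_2,\ldots,a_k\in\mathbb{F}_q$. Then the linear equation $a_1x_1+a_2x_2+\cdots+a_kx_k=1$ has a solution $(x_1,x_2,\ldots,x_k)\in \mathbb{F}_q^k$ with all $x_i$ distinct, unless one of the following holds: (i) $k<q$ and $a_1=a_2=\cdots=a_k=0$; (ii) $k=q$ and $a_1=a_2=\cdots=a_k=a$ for an element $a\in\mathbb{F}_q$. *)

theory Defs
  imports "HOL-Library.Cardinality" "HOL-Computational_Algebra.Computational_Algebra"
begin

end

theory Submission
  imports Defs "HOL-Combinatorics.Transposition"
begin

text \<open>Padding the coefficients with zeros reduces the case \<open>k < q\<close> to \<open>k = q\<close>, where \<open>x\<close> is a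
  bijection onto the field. The solution set is invariant under scaling, so it is enough to make
  the linear form nonzero; if it vanishes at \<open>x\<close>, exchanging the values of \<open>x\<close> at two indices
  with different coefficients makes it nonzero. Conversely, if all coefficients are equal, the form
  is a multiple of the sum of all field elements, which is zero as soon as some \<open>c \<noteq> 0, 1\<close> exists.\<close>

text \<open>Multiplication by \<open>c\<close> permutes the field, so the sum equals
  \<open>c\<close> times itself. Over the field with two elements no such \<open>c\<close> exists,
  and the sum is 1.\<close>

lemma sum_UNIV_field_eq_0:
  assumes "CARD('a::{field,finite}) \<ge> 3"
  shows "(\<Sum>x\<in>(UNIV :: 'a set). x) = 0"
proof -
  have "\<not> (UNIV :: 'a set) \<subseteq> {0, 1}"
    using assms card_mono[of "{0, 1 :: 'a}" UNIV] by fastforce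
  then obtain c :: 'a where c: "c \<noteq> 0" "c \<noteq> 1"
    by auto
  have "bij ((*) c)"
    using c(1) by (intro bij_betw_byWitness[where f' = "\<lambda>x. x / c"]) auto
  then have "(\<Sum>x\<in>(UNIV :: 'a set). c * x) = (\<Sum>x\<in>UNIV. x)"
    by (rule sum.reindex_bij_betw)
  then have "c * (\<Sum>x\<in>(UNIV :: 'a set). x) = (\<Sum>x\<in>UNIV. x)"
    by (simp only: sum_distrib_left)
  then show ?thesis
    using c(2) by simp
qed

text \<open>Only the terms at \<open>i\<close> and \<open>j\<close> change under the swap. Over a
  field the difference is nonzero once both the coefficients and the values at \<open>i\<close> and
  \<open>j\<close> differ.\<close>

lemma sum_transpose_diff:
  fixes b x :: "'i \<Rightarrow> 'a::comm_ring"
  assumes "finite I" "i \<in> I" "j \<in> I" "i \<noteq> j"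
  shows "(\<Sum>l\<in>I. b l * x (transpose i j l)) - (\<Sum>l\<in>I. b l * x l) = (b i - b j) * (x j - x i)"
proof -
  have "(\<Sum>l\<in>I. b l * x (transpose i j l)) - (\<Sum>l\<in>I. b l * x l)
      = (\<Sum>l\<in>I. b l * (x (transpose i j l) - x l))"
    by (simp add: sum_subtractf right_diff_distrib)
  also have "\<dots> = (\<Sum>l\<in>{i, j}. b l * (x (transpose i j l) - x l))"
    using assms by (intro sum.mono_neutral_right) (auto simp: transpose_def)
  also have "\<dots> = (b i - b j) * (x j - x i)"
    using assms(4) by (simp add: algebra_simps)
  finally show ?thesis .
qed

lemma ex_bij_betw_linear_form_eq_1:
  fixes b :: "'i \<Rightarrow> 'a::{field,finite}"
  assumes "finite I" "card I = CARD('a)" "i \<in> I" "j \<in> I" "b i \<noteq> b j"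
  shows "\<exists>x. bij_betw x I UNIV \<and> (\<Sum>l\<in>I. b l * x l) = 1"
proof -
  obtain x :: "'i \<Rightarrow> 'a" where x: "bij_betw x I UNIV"
    using finite_same_card_bij[OF assms(1) _ assms(2)] by auto
  have "i \<noteq> j"
    using assms(5) by auto
  then have "x i \<noteq> x j"
    using x assms(3,4) by (auto simp: bij_betw_def inj_on_def)
  then have "(\<Sum>l\<in>I. b l * x (transpose i j l)) \<noteq> (\<Sum>l\<in>I. b l * x l)"
    using sum_transpose_diff[OF assms(1,3,4) \<open>i \<noteq> j\<close>, of b x] assms(5) by auto
  moreover have "bij_betw (\<lambda>l. x (transpose i j l)) I UNIV"
    using bij_betw_trans[OF _ x, of "transpose i j" I] assms(3,4)
    by (simp add: comp_def bij_betw_transpose_iff)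
  \<comment> \<open>The form takes different values at \<open>x\<close> and at its swapped version,
    so at least one of the two serves as \<open>y\<close>.\<close>
  ultimately obtain y where y: "bij_betw y I UNIV" "(\<Sum>l\<in>I. b l * y l) \<noteq> 0"
    using x by metis
  define s where "s = (\<Sum>l\<in>I. b l * y l)"
  have "bij (\<lambda>z. z / s)"
    using y(2) by (intro bij_betw_byWitness[where f' = "\<lambda>z. z * s"]) (auto simp: s_def)
  then have "bij_betw (\<lambda>l. y l / s) I UNIV"
    using bij_betw_trans[OF y(1)] by (simp add: comp_def)
  moreover have "(\<Sum>l\<in>I. b l * (y l / s)) = 1"
    using y(2) by (simp add: s_def flip: sum_divide_distrib)
  ultimately show ?thesis
    by blast
qed

theorem theorem1p2:
  fixes q k :: nat
    and a :: "nat \<Rightarrow> 'a::{field,finite}"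
  assumes "CARD('a) = q"
    and "q \<ge> 3"
    and "1 \<le> k" and "k \<le> q"
  shows "(\<exists>x :: nat \<Rightarrow> 'a. inj_on x {1..k} \<and> (\<Sum>i=1..k. a i * x i) = 1) \<longleftrightarrow>
    \<not> ((k < q \<and> (\<forall>i\<in>{1..k}. a i = 0)) \<or>
        (k = q \<and> (\<exists>c::'a. \<forall>i\<in>{1..k}. a i = c)))"
    (is "?solvable \<longleftrightarrow> \<not> (?zero \<or> ?const)")
proof
  assume ?solvable
  then obtain x :: "nat \<Rightarrow> 'a" where x: "inj_on x {1..k}" "(\<Sum>i=1..k. a i * x i) = 1"
    by blast
  have False if ?const
  proof -
    from that obtain c where c: "k = q" "\<forall>i\<in>{1..k}. a i = c"
      by blast
    \<comment> \<open>An injection from \<open>q\<close> indices into a field of \<open>q\<close>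
      elements is onto.\<close>
    have "x ` {1..k} = UNIV"
      using x(1) c(1) assms(1) by (intro card_subset_eq) (auto simp: card_image)
    then have "(\<Sum>i=1..k. x i) = (\<Sum>z\<in>UNIV. z)"
      using sum.reindex[OF x(1), of "\<lambda>z. z"] by simp
    also have "\<dots> = 0"
      using sum_UNIV_field_eq_0 assms(1,2) by blast
    finally have "(\<Sum>i=1..k. a i * x i) = 0"
      using c(2) by (simp flip: sum_distrib_left)
    with x(2) show False
      by simp
  qed
  moreover have False if ?zero
    using x(2) that by simp
  ultimately show "\<not> (?zero \<or> ?const)"
    by blast
next
  assume neg: "\<not> (?zero \<or> ?const)"
  define b where "b i = (if i \<le> k then a i else 0)" for i
  have "\<exists>i\<in>{1..q}. \<exists>j\<in>{1..q}. b i \<noteq> b j"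
  proof (cases "k = q")
    case True
    have "\<not> (\<forall>i\<in>{1..k}. a i = a 1)"
      using neg True by blast
    then obtain i where "i \<in> {1..k}" "a i \<noteq> a 1"
      by blast
    then show ?thesis
      \<comment> \<open>With \<open>k = q\<close> there is no padding, so the two differing
        coefficients come from \<open>a\<close> itself.\<close>
      using assms True by (intro bexI[of _ i] bexI[of _ 1]) (auto simp: b_def)
  next
    case False
    then obtain i where "i \<in> {1..k}" "a i \<noteq> 0"
      using neg assms(4) by auto
    then show ?thesis
      \<comment> \<open>Since \<open>k < q\<close>, the index \<open>q\<close> lies in the padding
        and \<open>b q = 0\<close> differs from \<open>a i\<close>.\<close>
      using assms False by (intro bexI[of _ i] bexI[of _ q]) (auto simp: b_def)
  qed
  then obtain x :: "nat \<Rightarrow> 'a" where x: "bij_betw x {1..q} UNIV" "(\<Sum>i=1..q. b i * x i) = 1"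
    using ex_bij_betw_linear_form_eq_1[of "{1..q}"] assms(1) by fastforce
  \<comment> \<open>The padded terms vanish, so restricting \<open>x\<close> to the first
    \<open>k\<close> indices keeps the value 1.\<close>
  have "(\<Sum>i=1..q. b i * x i) = (\<Sum>i=1..k. a i * x i)"
    using assms(4) by (intro sum.mono_neutral_cong_right) (auto simp: b_def)
  moreover have "inj_on x {1..k}"
    using x(1) assms(4) by (auto simp: bij_betw_def intro: inj_on_subset)
  ultimately show ?solvable
    using x(2) by auto
qed

end
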